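(* Let $k\geq 2$ and $n\geq 50k^2$ be integers. Let $(G,C)$ be an edge-colored graph on $n$ vertices. If $\delta^c(G)\geq \frac{n}{2}+k-1$, then $G$ contains $k$ rainbow triangles sharing one common vertex (that is, $k$ rainbow triangles whose union is a friendship graph $F_k$).
   Context: All graphs are finite, undirected and simple. An edge-colored graph $(G,C)$ is a graph $G$ with an arbitrary function $C:E(G)\to\mathbb{N}$ (not necessarily a proper coloring). The color degree $d^c(v)$ is the number of distinct colors appearing on edges incident with $v$; $\delta^c(G)=\min_{v\in V(G)} d^c(v)$. A triangle is rainbow if its three edges have pairwise distinct colors (edges of different triangles may share colors). The friendship graph $F_k$ consists of $k$ triangles sharing a common vertex and otherwise pairwise vertex-disjoint. *)

theory Defs
  imports Complex_Main "HOL-Library.Ramsey"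
begin

(* A graph is a vertex set together with a set of edges, each edge being a 2-element set of
   vertices.  A coloring is a total function on sets of vertices; it is only ever consulted
   on edges, and no properness is required. *)

definition finite_simple_graph :: "'a set \<Rightarrow> 'a set set \<Rightarrow> bool" where
  "finite_simple_graph V E \<longleftrightarrow> finite V \<and> E \<subseteq> nsets V 2"

definition color_degree :: "'a set set \<Rightarrow> ('a set \<Rightarrow> nat) \<Rightarrow> 'a \<Rightarrow> nat" where
  "color_degree E C v = card (C ` {e \<in> E. v \<in> e})"

(* Meaningful only for a finite nonempty vertex set. *)
definition min_color_degree :: "'a set \<Rightarrow> 'a set set \<Rightarrow> ('a set \<Rightarrow> nat) \<Rightarrow> nat" where
  "min_color_degree V E C = Min (color_degree E C ` V)"

(* A triangle is identified with its set of three vertices; its edges are then "nsets T 2". *)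
definition is_triangle :: "'a set \<Rightarrow> 'a set set \<Rightarrow> 'a set \<Rightarrow> bool" where
  "is_triangle V E T \<longleftrightarrow> T \<in> nsets V 3 \<and> nsets T 2 \<subseteq> E"

definition rainbow_triangle ::
  "'a set \<Rightarrow> 'a set set \<Rightarrow> ('a set \<Rightarrow> nat) \<Rightarrow> 'a set \<Rightarrow> bool" where
  "rainbow_triangle V E C T \<longleftrightarrow> is_triangle V E T \<and> inj_on C (nsets T 2)"

(* \<T> is the set of triangles of a friendship graph F_k with center v: any two distinct
   triangles meet in v and nowhere else.  Colors may repeat between different triangles. *)
definition friendship_triangles :: "nat \<Rightarrow> 'a \<Rightarrow> 'a set set \<Rightarrow> bool" where
  "friendship_triangles k v \<T> \<longleftrightarrow>
     finite \<T> \<and> card \<T> = k \<and> (\<forall>T\<in>\<T>. card T = 3 \<and> v \<in> T) \<and> pairwise (\<lambda>S T. S \<inter> T = {v}) \<T>"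

end

theory Submission
  imports Defs
begin

text \<open>
  Fix a vertex \<open>v\<close> and call the \<^emph>\<open>link\<close> of \<open>v\<close> the graph of all pairs \<open>{x, y}\<close> that form a rainbow
  triangle with \<open>v\<close>.  A friendship graph of \<open>k\<close> rainbow triangles centered at \<open>v\<close> is a matching of
  size \<open>k\<close> in the link, so the task is to find a \<open>v\<close> whose link has such a matching.  Two estimates
  pull in opposite directions.

  A graph without a matching of size \<open>k\<close> is essentially covered by \<open>k - 1\<close> vertices: outside a set \<open>H\<close>
  of that size it has only \<open>O(k\<^sup>2)\<close> edges, independently of \<open>n\<close>
  (\<open>matching_concentrates_edges\<close>).

  On the other hand, for a suitable \<open>v\<close> no set \<open>H\<close> of \<open>k - 1\<close> vertices can absorb the link.  Delete
  edges as long as no color degree drops; in the remaining graph every edge is alone in its color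
  at one of its ends, so every color class is a union of stars (\<open>critical_subgraph\<close>).  Let \<open>v\<close> and a
  color \<open>c\<close> at \<open>v\<close> be chosen such that the set \<open>S\<close> of \<open>c\<close>-colored neighbors is as large as possible over all vertices and colors,
  and let \<open>A\<close> contain one neighbor of \<open>v\<close> for each other color.  A vertex \<open>x\<close> of \<open>A\<close> sees at least
  \<open>d - 1\<close> colors besides the color of \<open>vx\<close>, where \<open>d\<close> is the minimum color degree, and the set \<open>A \<union> S\<close>
  misses few vertices, so \<open>x\<close> has at least \<open>2d - n + |S| - 1\<close> neighbors \<open>y\<close> in \<open>A \<union> S\<close> along edges
  of a color different from that of \<open>vx\<close>.  The triangle \<open>vxy\<close> then is rainbow unless \<open>xy\<close> and \<open>vy\<close> have
  the same color.  By criticality this never happens for \<open>y\<close> in \<open>S\<close>, and by the choice of \<open>v\<close> and \<open>c\<close> it happens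
  for at most \<open>|S| - 1\<close> vertices \<open>x\<close> when \<open>y\<close> is fixed.  Hence the size of \<open>S\<close> cancels, and at least
  \<open>2d - n - |H|\<close> rainbow pairs per vertex of \<open>A - H\<close>, on average, avoid \<open>H\<close> (\<open>rainbow_arcs_avoiding\<close>).

  With \<open>2d - n \<ge> 2(k - 1)\<close> and \<open>|H| \<le> k - 1\<close> this is about \<open>(k - 1) n / 2\<close> pairs, which exceeds
  \<open>O(k\<^sup>2)\<close> once \<open>n\<close> is large compared with \<open>k\<close>.
\<close>

section \<open>Matchings and heavy vertices\<close>

text \<open>
  Let \<open>W\<close> be the vertex set of a maximum matching.  Every edge meets \<open>W\<close>.  The set \<open>H\<close> consists of the
  vertices of \<open>W\<close> with at least two neighbors outside \<open>W\<close>.  A matching edge with both ends in \<open>H\<close> could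
  be exchanged for two edges that leave \<open>W\<close>, so \<open>H\<close> has at most one vertex per matching edge; each
  other vertex of \<open>W\<close> lies on at most \<open>|W| + 1\<close> edges.  The bound counts ordered pairs, hence
  every edge twice.
\<close>
lemma matching_concentrates_edges:
  fixes L :: "'a set set"
  assumes finL: "finite L" and two: "\<And>e. e \<in> L \<Longrightarrow> card e = 2"
    and nomatch: "\<And>M. \<lbrakk>M \<subseteq> L; pairwise disjnt M\<rbrakk> \<Longrightarrow> card M \<noteq> k"
  obtains H where "finite H" and "card H \<le> k - 1"
    and "card {(x, y). {x, y} \<in> L \<and> x \<notin> H \<and> y \<notin> H} \<le> 4 * (k - 1) * (2 * k - 1)"
proof -
  define matching where "matching M \<longleftrightarrow> M \<subseteq> L \<and> pairwise disjnt M" for M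
  have "matching {}" by (simp add: matching_def)
  moreover have "\<forall>M. matching M \<longrightarrow> card M < Suc (card L)"
    using card_mono[OF finL] by (auto simp: matching_def less_Suc_eq_le)
  ultimately obtain M where M: "matching M" and Mmax: "\<And>N. matching N \<Longrightarrow> card N \<le> card M"
    using ex_has_greatest_nat[of matching "{}" card "Suc (card L)"] by blast
  have M_sub: "M \<subseteq> L" and Mdis: "pairwise disjnt M" using M by (auto simp: matching_def)
  have finM: "finite M" using M_sub finL finite_subset by blast
  have cardM: "card M < k"
  proof (rule ccontr)
    assume "\<not> card M < k"
    then obtain N where "N \<subseteq> M" "card N = k"
      using obtain_subset_with_card_n[of k M] by auto
    then show False using nomatch[of N] M_sub pairwise_subset[OF Mdis] by blast
  qed
  define W where "W = \<Union>M"
  have fine: "finite e" if "e \<in> L" for e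
    using two[OF that] card.infinite by fastforce
  have finW: "finite W" unfolding W_def using finM fine M_sub by blast
  have cardW: "card W \<le> 2 * (k - 1)"
  proof -
    have "card W \<le> sum card M" unfolding W_def by (rule card_Union_le_sum_card)
    also have "\<dots> = 2 * card M" using two M_sub by (simp add: subset_iff)
    finally show ?thesis using cardM by linarith
  qed
  define N where "N a = {x. {a, x} \<in> L \<and> x \<notin> W}" for a
  have finN: "finite (N a)" for a
  proof (rule finite_subset)
    show "N a \<subseteq> \<Union>L" by (auto simp: N_def)
    show "finite (\<Union>L)" using finL fine by blast
  qed
  define H where "H = {a \<in> W. 2 \<le> card (N a)}"
  (* The exchange step: e is replaced by ax and by, with distinct x and y outside W. *)
  have augment: False if "e \<in> M" "a \<in> e" "b \<in> e" and ab: "a \<noteq> b" and aH: "a \<in> H" and bH: "b \<in> H" for e a b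
  proof -
    have e: "e = {a, b}"
      using that two[of e] M_sub by (auto simp: card_2_iff)
    obtain x where x: "x \<in> N a" using aH by (fastforce simp: H_def)
    have "\<exists>y\<in>N b. y \<noteq> x"
    proof (rule ccontr)
      assume "\<not> ?thesis"
      then have "N b \<subseteq> {x}" by auto
      then have "card (N b) \<le> 1" using card_mono[of "{x}" "N b"] by simp
      then show False using bH by (simp add: H_def)
    qed
    then obtain y where y: "y \<in> N b" "y \<noteq> x" by blast
    have abW: "a \<in> W" "b \<in> W" using that by (auto simp: W_def)
    have xyW: "x \<notin> W" "y \<notin> W" "{a, x} \<in> L" "{b, y} \<in> L" using x y by (auto simp: N_def)
    have other: "a \<notin> f" "b \<notin> f" "x \<notin> f" "y \<notin> f" if "f \<in> M - {e}" for f
    proof -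
      have "disjnt e f" using Mdis \<open>e \<in> M\<close> that by (metis DiffD1 DiffD2 insertI1 pairwiseD)
      then show "a \<notin> f" "b \<notin> f" using e by auto
      show "x \<notin> f" "y \<notin> f" using xyW that by (auto simp: W_def)
    qed
    define M' where "M' = insert {a, x} (insert {b, y} (M - {e}))"
    have "pairwise disjnt (M - {e})" by (rule pairwise_subset[OF Mdis]) auto
    moreover have "disjnt {a, x} {b, y}" using ab y xyW abW by auto
    ultimately have "pairwise disjnt M'"
      using other unfolding M'_def by (auto simp: pairwise_insert disjnt_sym)
    then have "matching M'" using M_sub xyW by (auto simp: matching_def M'_def)
    moreover have "card M' = Suc (card M)"
    proof -
      have "{b, y} \<notin> M - {e}" using other by blast
      moreover have "{a, x} \<notin> insert {b, y} (M - {e})"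
        using other \<open>disjnt {a, x} {b, y}\<close> by auto
      ultimately show ?thesis unfolding M'_def using finM \<open>e \<in> M\<close>
        by (simp add: card_Suc_Diff1 del: card_Diff_singleton card_Diff_insert)
    qed
    ultimately show False using Mmax by fastforce
  qed
  have cardH: "card H \<le> card M"
  proof -
    define f where "f a = (SOME e. e \<in> M \<and> a \<in> e)" for a
    have f: "f a \<in> M \<and> a \<in> f a" if "a \<in> H" for a
      unfolding f_def by (rule someI_ex) (use that in \<open>auto simp: H_def W_def\<close>)
    have "inj_on f H" using f augment by (intro inj_onI) metis
    then show ?thesis using f finM by (intro card_inj_on_le[of f]) auto
  qed
  (* All edges avoiding H, each directed away from an end in W. *)
  define B where "B = (SIGMA x:W - H. W \<union> N x)"
  have "card B \<le> (\<Sum>x\<in>W - H. 2 * (k - 1) + 1)"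
  proof -
    have "card B = (\<Sum>x\<in>W - H. card (W \<union> N x))"
      unfolding B_def using finW finN by simp
    also have "\<dots> \<le> (\<Sum>x\<in>W - H. 2 * (k - 1) + 1)"
    proof (rule sum_mono)
      fix x assume "x \<in> W - H"
      then have "card (N x) \<le> 1" by (auto simp: H_def)
      then show "card (W \<union> N x) \<le> 2 * (k - 1) + 1"
        using card_Un_le[of W "N x"] cardW by linarith
    qed
    finally show ?thesis .
  qed
  also have "\<dots> \<le> 2 * (k - 1) * (2 * k - 1)"
  proof -
    have "card (W - H) \<le> 2 * (k - 1)"
      using card_mono[OF finW, of "W - H"] cardW by auto
    moreover have "2 * (k - 1) + 1 = 2 * k - 1" using cardM by linarith
    ultimately show ?thesis by simp
  qed
  finally have cardB: "card B \<le> 2 * (k - 1) * (2 * k - 1)" .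
  have finB: "finite B" unfolding B_def using finW finN by blast
  have "{(x, y). {x, y} \<in> L \<and> x \<notin> H \<and> y \<notin> H} \<subseteq> B \<union> B\<inverse>"
  proof (rule subrelI)
    fix x y assume "(x, y) \<in> {(x, y). {x, y} \<in> L \<and> x \<notin> H \<and> y \<notin> H}"
    then have xy: "{x, y} \<in> L" "x \<notin> H" "y \<notin> H" by auto
    have "x \<in> W \<or> y \<in> W"
    proof (rule ccontr)
      assume "\<not> ?thesis"
      then have disj: "disjnt {x, y} f" if "f \<in> M" for f using that by (auto simp: W_def)
      then have "matching (insert {x, y} M)"
        using xy M by (auto simp: matching_def pairwise_insert disjnt_sym)
      moreover have "{x, y} \<notin> M" using disj[of "{x, y}"] by (auto simp: disjnt_def)
      ultimately show False using Mmax[of "insert {x, y} M"] finM by simp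
    qed
    then show "(x, y) \<in> B \<union> B\<inverse>"
      using xy by (auto simp: B_def N_def insert_commute)
  qed
  then have "card {(x, y). {x, y} \<in> L \<and> x \<notin> H \<and> y \<notin> H} \<le> card (B \<union> B\<inverse>)"
    using finB by (intro card_mono) auto
  also have "\<dots> \<le> card B + card (B\<inverse>)" by (rule card_Un_le)
  also have "\<dots> \<le> 4 * (k - 1) * (2 * k - 1)" using cardB by (simp add: algebra_simps)
  finally show ?thesis
    using that[of H] finW cardH cardM by (simp add: H_def)
qed

section \<open>Graphs that are critical for the color degree\<close>

text \<open>
  In a spanning subgraph with the fewest edges, an edge whose color is repeated at both of its ends
  could be deleted without any vertex losing a color.
\<close>
lemma critical_subgraph:
  assumes "finite E" and "\<forall>u\<in>V. d \<le> color_degree E C u"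
  obtains F where "F \<subseteq> E" and "\<forall>u\<in>V. d \<le> color_degree F C u"
    and "\<forall>e\<in>F. \<exists>u\<in>e. \<forall>f\<in>F. u \<in> f \<and> C f = C e \<longrightarrow> f = e"
proof -
  define good where "good F \<longleftrightarrow> F \<subseteq> E \<and> (\<forall>u\<in>V. d \<le> color_degree F C u)" for F
  have "good E" using assms by (simp add: good_def)
  then obtain F where F: "good F" and Fmin: "\<And>F'. good F' \<Longrightarrow> card F \<le> card F'"
    using ex_has_least_nat[of good E card] by blast
  have "\<exists>u\<in>e. \<forall>f\<in>F. u \<in> f \<and> C f = C e \<longrightarrow> f = e" if "e \<in> F" for e
  proof (rule ccontr)
    assume "\<not> ?thesis"
    then have twin: "\<exists>f\<in>F - {e}. u \<in> f \<and> C f = C e" if "u \<in> e" for u using that by auto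
    have "C ` {f \<in> F - {e}. u \<in> f} = C ` {f \<in> F. u \<in> f}" for u
    proof
      show "C ` {f \<in> F. u \<in> f} \<subseteq> C ` {f \<in> F - {e}. u \<in> f}"
      proof clarify
        fix f assume f: "f \<in> F" "u \<in> f"
        obtain g where "g \<in> F - {e}" "u \<in> g" "C g = C f"
          using f twin[of u] by (cases "f = e") auto
        then show "C f \<in> C ` {f \<in> F - {e}. u \<in> f}" by (metis (mono_tags, lifting) image_eqI mem_Collect_eq)
      qed
    qed auto
    then have "good (F - {e})" using F by (auto simp: good_def color_degree_def)
    then have "card F \<le> card (F - {e})" by (rule Fmin)
    moreover have "finite F" using F assms finite_subset by (auto simp: good_def)
    ultimately show False using \<open>e \<in> F\<close> card_Diff1_less[of F e] by linarith
  qed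
  then show ?thesis using that[of F] F by (auto simp: good_def)
qed

section \<open>Rainbow triangles at a vertex of largest monochromatic degree\<close>

definition color_nbrs :: "'a set set \<Rightarrow> ('a set \<Rightarrow> nat) \<Rightarrow> 'a \<Rightarrow> nat \<Rightarrow> 'a set" where
  "color_nbrs E C v c = {u. {v, u} \<in> E \<and> C {v, u} = c}"

lemma edge_ends:
  assumes "finite_simple_graph V E" and "{x, y} \<in> E"
  shows "x \<in> V" and "y \<in> V" and "x \<noteq> y"
proof -
  have "{x, y} \<in> nsets V 2" using assms unfolding finite_simple_graph_def by blast
  then have "{x, y} \<subseteq> V" and "card {x, y} = 2" by (auto simp only: nsets_def)
  then show "x \<in> V" "y \<in> V" "x \<noteq> y" by auto
qed

lemma color_degree_eq_card_nbr_colors: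
  assumes "finite_simple_graph V E"
  shows "color_degree E C v = card ((\<lambda>u. C {v, u}) ` {u. {v, u} \<in> E})"
proof -
  have "{e \<in> E. v \<in> e} = (\<lambda>u. {v, u}) ` {u. {v, u} \<in> E}"
  proof (intro equalityI subsetI)
    fix e assume e: "e \<in> {e \<in> E. v \<in> e}"
    then have "card e = 2" using assms by (auto simp: finite_simple_graph_def nsets_def)
    then obtain u where "e = {v, u}" using e by (auto simp: card_2_iff)
    then show "e \<in> (\<lambda>u. {v, u}) ` {u. {v, u} \<in> E}" using e by auto
  qed auto
  then show ?thesis by (simp add: color_degree_def image_image)
qed

lemma rainbow_triangleI:
  assumes G: "finite_simple_graph V E"
    and "{v, x} \<in> E" "{v, y} \<in> E" "{x, y} \<in> E"
    and "C {v, x} \<noteq> C {v, y}" "C {x, y} \<noteq> C {v, x}" "C {x, y} \<noteq> C {v, y}"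
  shows "rainbow_triangle V E C {v, x, y}"
proof -
  have d: "v \<noteq> x" "v \<noteq> y" "x \<noteq> y" "{v, x, y} \<subseteq> V"
    using edge_ends[OF G] assms(2-4) by auto
  have "nsets {v, x, y} 2 = {{v, x}, {v, y}, {x, y}}"
    using d by (auto simp: nsets_2_eq insert_commute)
  moreover have "{v, x, y} \<in> nsets V 3" using d by (auto simp: nsets_def)
  ultimately show ?thesis
    using assms by (auto simp: rainbow_triangle_def is_triangle_def inj_on_def)
qed

lemma rainbow_triangle_mono:
  "\<lbrakk>rainbow_triangle V F C T; F \<subseteq> E\<rbrakk> \<Longrightarrow> rainbow_triangle V E C T"
  by (auto simp: rainbow_triangle_def is_triangle_def)

text \<open>
  The counting step.  The vertex \<open>v\<close> and the set \<open>A\<close> are chosen before \<open>H\<close>, because \<open>H\<close> is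
  later derived from the link of \<open>v\<close>.  In the conclusion, the monochromatic degree
  of \<open>v\<close> has cancelled: the larger \<open>S\<close> is, the more pairs can fail to be rainbow, but also the more
  vertices \<open>A \<union> S\<close> contains.  The inequality has only sums on both sides to avoid truncated
  subtraction.
\<close>
lemma rainbow_arcs_avoiding:
  assumes G: "finite_simple_graph V F" and ne: "V \<noteq> {}" and "d \<ge> 1"
    and deg: "\<forall>u\<in>V. d \<le> color_degree F C u"
    and crit: "\<forall>e\<in>F. \<exists>u\<in>e. \<forall>f\<in>F. u \<in> f \<and> C f = C e \<longrightarrow> f = e"
  obtains v A where "v \<in> V" and "finite A" and "d \<le> card A + 1"
    and "\<And>H. finite H \<Longrightarrow> card (A - H) * (2 * d) \<le> card (A - H) * (card V + card H)
          + card {(x, y). rainbow_triangle V F C {v, x, y} \<and> x \<notin> H \<and> y \<notin> H}"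
proof -
  have finV: "finite V" using G by (simp add: finite_simple_graph_def)
  have loopless: "{u} \<notin> F" for u using edge_ends(3)[OF G, of u u] by auto
  have nbrV: "color_nbrs F C u c \<subseteq> V - {u}" for u c
    using loopless by (auto simp: color_nbrs_def dest: edge_ends(2)[OF G])
  have finN: "finite (color_nbrs F C u c)" for u c
    using nbrV finV finite_subset by (metis finite_Diff)
  have "\<forall>p. True \<longrightarrow> card (color_nbrs F C (fst p) (snd p)) < Suc (card V)"
    using nbrV by (meson Diff_subset card_mono finV le_imp_less_Suc order_trans)
  then obtain p where p: "\<And>q. card (color_nbrs F C (fst q) (snd q)) \<le> card (color_nbrs F C (fst p) (snd p))"
    using ex_has_greatest_nat[of "\<lambda>_. True" undefined "\<lambda>p. card (color_nbrs F C (fst p) (snd p))" "Suc (card V)"]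
    by blast
  obtain v c where "p = (v, c)" by fastforce
  define S where "S = color_nbrs F C v c"
  have max: "card (color_nbrs F C u b) \<le> card S" for u b
    using p[of "(u, b)"] \<open>p = (v, c)\<close> by (simp add: S_def)
  have finS: "finite S" using finN by (simp add: S_def)
  have "card S \<ge> 1"
  proof -
    obtain u where "u \<in> V" using ne by blast
    then have "color_degree F C u \<ge> 1" using deg \<open>d \<ge> 1\<close> by fastforce
    then obtain w where "{u, w} \<in> F"
      unfolding color_degree_eq_card_nbr_colors[OF G] by (fastforce simp: card_gt_0_iff)
    then have "color_nbrs F C u (C {u, w}) \<noteq> {}" by (auto simp: color_nbrs_def)
    then show ?thesis using max[of u "C {u, w}"] finN[of u "C {u, w}"]
      by (metis card_0_eq le_zero_eq not_less_eq_eq One_nat_def)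
  qed
  then obtain s where s: "s \<in> S" by fastforce
  have vV: "v \<in> V" using s by (auto simp: S_def color_nbrs_def dest: edge_ends(1)[OF G])
  define K where "K = (\<lambda>u. C {v, u}) ` {u. {v, u} \<in> F} - {c}"
  have K: "d \<le> card K + 1"
  proof -
    have "c \<in> (\<lambda>u. C {v, u}) ` {u. {v, u} \<in> F}" using s by (auto simp: S_def color_nbrs_def)
    moreover have "finite {u. {v, u} \<in> F}"
      by (rule finite_subset[OF _ finV]) (auto dest: edge_ends(2)[OF G])
    ultimately have "card K = color_degree F C v - 1"
      unfolding K_def color_degree_eq_card_nbr_colors[OF G] by simp
    then show ?thesis using deg vV by fastforce
  qed
  have "\<exists>A\<subseteq>{u. {v, u} \<in> F}. inj_on (\<lambda>u. C {v, u}) A \<and> K = (\<lambda>u. C {v, u}) ` A"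
    using subset_image_inj[of K "\<lambda>u. C {v, u}" "{u. {v, u} \<in> F}"] by (auto simp: K_def)
  then obtain A where AF: "A \<subseteq> {u. {v, u} \<in> F}" and Ainj: "inj_on (\<lambda>u. C {v, u}) A"
    and KA: "K = (\<lambda>u. C {v, u}) ` A" by blast
  have AV: "A \<subseteq> V - {v}" using AF loopless by (auto dest: edge_ends(2)[OF G])
  have SV: "S \<subseteq> V - {v}" using nbrV by (simp add: S_def)
  have finA: "finite A" using AV finV finite_subset by blast
  have cardA: "d \<le> card A + 1" using K KA card_image[OF Ainj] by simp
  have Ac: "C {v, a} \<noteq> c" if "a \<in> A" for a using that KA by (auto simp: K_def)
  have AS: "A \<inter> S = {}" using Ac by (auto simp: S_def color_nbrs_def)
  have vS: "{v, y} \<in> F" "C {v, y} = c" if "y \<in> S" for y using that by (auto simp: S_def color_nbrs_def)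
  (* If v sees c only once, then S = {y} although y sees c at least twice, against the choice of v, c. *)
  have into_S: "C {x, y} \<noteq> c" if "y \<in> S" "{x, y} \<in> F" "x \<noteq> v" for x y
  proof
    assume c: "C {x, y} = c"
    have "\<exists>u\<in>{v, y}. \<forall>f\<in>F. u \<in> f \<and> C f = c \<longrightarrow> f = {v, y}"
      using crit vS[OF that(1)] by metis
    then consider "\<forall>f\<in>F. v \<in> f \<and> C f = c \<longrightarrow> f = {v, y}" | "\<forall>f\<in>F. y \<in> f \<and> C f = c \<longrightarrow> f = {v, y}"
      by blast
    then show False
    proof cases
      case 1
      have "S \<subseteq> {y}"
      proof
        fix z assume "z \<in> S"
        then have "{v, z} = {v, y}" using 1 vS by blast
        then show "z \<in> {y}" using \<open>z \<in> S\<close> by (auto simp: doubleton_eq_iff)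
      qed
      then have "card S \<le> 1" using card_mono[of "{y}" S] by simp
      moreover have "{v, x} \<subseteq> color_nbrs F C y c"
        using that c vS[OF that(1)] by (auto simp: color_nbrs_def insert_commute)
      then have "2 \<le> card (color_nbrs F C y c)"
        using card_mono[OF finN[of y c], of "{v, x}"] that(3) by simp
      ultimately show False using max[of y c] by linarith
    next
      case 2
      then have "{x, y} = {v, y}" using that c by blast
      then show False using that(3) by (auto simp: doubleton_eq_iff)
    qed
  qed
  have count: "card (A - H) * (2 * d) \<le> card (A - H) * (card V + card H)
          + card {(x, y). rainbow_triangle V F C {v, x, y} \<and> x \<notin> H \<and> y \<notin> H}" 
    if finH: "finite H" for H
  proof -
    define X where "X = A - H"
    have finX: "finite X" using finA by (simp add: X_def)
    define R where "R x = {y. {x, y} \<in> F \<and> C {x, y} \<noteq> C {v, x}}" for x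
    have RV: "R x \<subseteq> V - {v}" for x by (auto simp: R_def insert_commute dest: edge_ends[OF G])
    have finR: "finite (R x)" for x using RV finV finite_subset by (metis finite_Diff)
    have cardR: "2 * d + card S \<le> card (R x \<inter> (A \<union> S)) + card V + 1" if "x \<in> X" for x
    proof -
      have xv: "{v, x} \<in> F" using that AF by (auto simp: X_def)
      have xV: "x \<in> V" using edge_ends[OF G xv] by simp
      have "d \<le> card ((\<lambda>u. C {x, u}) ` {u. {x, u} \<in> F})"
        using deg xV color_degree_eq_card_nbr_colors[OF G] by metis
      also have "\<dots> \<le> card (insert (C {v, x}) ((\<lambda>u. C {x, u}) ` R x))"
        by (rule card_mono) (use finR in \<open>auto simp: R_def\<close>)
      also have "\<dots> \<le> card (R x) + 1"
        using card_image_le[OF finR[of x], of "\<lambda>u. C {x, u}"] finR[of x]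
        by (simp add: card_insert_if)
      finally have "d \<le> card (R x) + 1" .
      moreover have "card (R x \<union> (A \<union> S)) \<le> card (V - {v})"
        using RV AV SV finV by (intro card_mono) auto
      moreover have "card (V - {v}) + 1 = card V"
        using vV finV by (metis Suc_eq_plus1 card_Suc_Diff1)
      moreover have "card (A \<union> S) = card A + card S"
        using card_Un_disjoint[OF finA finS AS] .
      moreover have "card (R x) + card (A \<union> S) = card (R x \<union> (A \<union> S)) + card (R x \<inter> (A \<union> S))"
        using card_Un_Int[OF finR[of x], of "A \<union> S"] finA finS by simp
      ultimately show ?thesis using cardA by linarith
    qed
    (* P: the pairs that are counted; T: the reversed pairs (y, x) for which xy repeats the color of vy. *)
    define P where "P = (SIGMA x:X. R x \<inter> (A \<union> S))"
    define Q where "Q = {(x, y). rainbow_triangle V F C {v, x, y} \<and> x \<notin> H \<and> y \<notin> H}"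
    define T where "T = (SIGMA y:X. color_nbrs F C y (C {v, y}) - {v})"
    have finT: "finite T" unfolding T_def using finX finN by blast
    have "Q \<subseteq> V \<times> V" by (auto simp: Q_def rainbow_triangle_def is_triangle_def nsets_def)
    then have finQ: "finite Q" using finV finite_subset by blast
    have "P \<subseteq> X \<times> H \<union> T\<inverse> \<union> Q"
    proof (rule subrelI, rule ccontr)
      fix x y assume xy: "(x, y) \<in> P" and uncovered: "(x, y) \<notin> X \<times> H \<union> T\<inverse> \<union> Q"
      have x: "x \<in> A" "x \<notin> H" "x \<in> X" and y: "y \<in> A \<union> S" "{x, y} \<in> F" "C {x, y} \<noteq> C {v, x}"
        using xy by (auto simp: P_def X_def R_def)
      have vx: "{v, x} \<in> F" "x \<noteq> v" using x AF AV by auto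
      have vy: "{v, y} \<in> F" using y AF vS by auto
      have "x \<noteq> y" using edge_ends[OF G y(2)] by simp
      then have cvxy: "C {v, x} \<noteq> C {v, y}"
        using y(1) x(1) Ainj Ac vS by (auto simp: inj_on_def)
      have nQ: "(x, y) \<notin> Q" and nT: "(x, y) \<notin> T\<inverse>" and "y \<notin> H" using uncovered x by auto
      have "\<not> rainbow_triangle V F C {v, x, y}" using nQ x \<open>y \<notin> H\<close> by (auto simp: Q_def)
      then have cxy: "C {x, y} = C {v, y}"
        using rainbow_triangleI[OF G vx(1) vy y(2) cvxy y(3)] by blast
      then have "y \<notin> S" using into_S[OF _ y(2) vx(2)] vS by metis
      then have "y \<in> X" using y \<open>y \<notin> H\<close> by (auto simp: X_def)
      then show False using nT y(2) cxy vx(2)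
        by (auto simp: T_def color_nbrs_def insert_commute)
    qed
    then have "card P \<le> card (X \<times> H \<union> T\<inverse> \<union> Q)"
      using finX finH finT finQ by (intro card_mono) auto
    also have "\<dots> \<le> card (X \<times> H) + card (T\<inverse>) + card Q"
      using card_Un_le[of "X \<times> H \<union> T\<inverse>" Q] card_Un_le[of "X \<times> H" "T\<inverse>"] by linarith
    finally have P_le: "card P \<le> card X * card H + card T + card Q"
      by (simp add: card_cartesian_product)
    (* The vertex v itself is a neighbor of y in the color of vy, which saves one per y. *)
    have "card T + card X \<le> card X * card S"
    proof -
      have "card T + card X = (\<Sum>y\<in>X. card (color_nbrs F C y (C {v, y}) - {v}) + 1)"
        unfolding T_def sum.distrib using finX finN by simp
      also have "\<dots> \<le> (\<Sum>y\<in>X. card S)"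
      proof (rule sum_mono)
        fix y assume "y \<in> X"
        then have "v \<in> color_nbrs F C y (C {v, y})"
          using AF by (auto simp: X_def color_nbrs_def insert_commute)
        then have "card (color_nbrs F C y (C {v, y}) - {v}) + 1 = card (color_nbrs F C y (C {v, y}))"
          using finN by (metis Suc_eq_plus1 card_Suc_Diff1)
        then show "card (color_nbrs F C y (C {v, y}) - {v}) + 1 \<le> card S" using max by simp
      qed
      finally show ?thesis by simp
    qed
    moreover have "card X * (2 * d + card S) \<le> card P + card X * (card V + 1)"
    proof -
      have "card X * (2 * d + card S) = (\<Sum>x\<in>X. 2 * d + card S)" by simp
      also have "\<dots> \<le> (\<Sum>x\<in>X. card (R x \<inter> (A \<union> S)) + (card V + 1))"
        using cardR by (intro sum_mono) (simp add: add.assoc)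
      also have "\<dots> = card P + card X * (card V + 1)"
        unfolding P_def sum.distrib using finX finR by simp
      finally show ?thesis .
    qed
    ultimately show ?thesis
      using P_le unfolding X_def[symmetric] Q_def[symmetric] by (simp add: algebra_simps)
  qed
  show ?thesis by (rule that[OF vV finA cardA count])
qed

section \<open>Friendship graphs of rainbow triangles\<close>

lemma friendship_triangles_of_matching:
  assumes "finite M" and "pairwise disjnt M" and "\<And>e. e \<in> M \<Longrightarrow> card e = 2 \<and> v \<notin> e"
  shows "friendship_triangles (card M) v (insert v ` M)"
proof -
  have "inj_on (insert v) M" using assms(3) by (intro inj_onI) (metis insert_ident)
  then have "card (insert v ` M) = card M" by (rule card_image)
  moreover have "card (insert v e) = 3" if "e \<in> M" for e
    using assms(3)[OF that] card_ge_0_finite[of e] by simp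
  moreover have "pairwise (\<lambda>S T. S \<inter> T = {v}) (insert v ` M)"
    using assms(2) by (fastforce simp: pairwise_def disjnt_def)
  ultimately show ?thesis using assms(1) by (auto simp: friendship_triangles_def)
qed

theorem theorem9:
  fixes k n :: nat and V :: "'a set" and E :: "'a set set" and C :: "'a set \<Rightarrow> nat"
  assumes "k \<ge> 2"
    and "n \<ge> 50 * k^2"
    and "finite_simple_graph V E"
    and "card V = n"
    and "real (min_color_degree V E C) \<ge> real n / 2 + real k - 1"
  shows "\<exists>v\<in>V. \<exists>\<T>. friendship_triangles k v \<T> \<and> (\<forall>T\<in>\<T>. rainbow_triangle V E C T)"
proof (rule ccontr)
  assume no: "\<not> ?thesis"
  have finV: "finite V" and EV: "E \<subseteq> nsets V 2" using assms(3) by (auto simp: finite_simple_graph_def)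
  have finE: "finite E" using finite_subset[OF EV] finite_imp_finite_nsets[OF finV] by blast
  have "2 * k \<le> k^2" using assms(1) by (simp add: power2_eq_square)
  then have n_large: "n \<ge> 100 * k" using assms(2) by linarith
  then have neV: "V \<noteq> {}" using assms(1,4) by auto
  define d where "d = min_color_degree V E C"
  have d: "2 * d + 2 \<ge> n + 2 * k" using assms(5) unfolding d_def[symmetric] by linarith
  have "\<forall>u\<in>V. d \<le> color_degree E C u" using finV by (simp add: d_def min_color_degree_def)
  then obtain F where FE: "F \<subseteq> E" and degF: "\<forall>u\<in>V. d \<le> color_degree F C u"
    and crit: "\<forall>e\<in>F. \<exists>u\<in>e. \<forall>f\<in>F. u \<in> f \<and> C f = C e \<longrightarrow> f = e"
    using critical_subgraph[OF finE] by blast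
  have GF: "finite_simple_graph V F" using FE EV finV by (auto simp: finite_simple_graph_def)
  have "d \<ge> 1" using d n_large assms(1) by linarith
  then obtain v A where v: "v \<in> V" and A: "finite A" "d \<le> card A + 1"
    and arcs: "\<And>H. finite H \<Longrightarrow> card (A - H) * (2 * d) \<le> card (A - H) * (card V + card H)
          + card {(x, y). rainbow_triangle V F C {v, x, y} \<and> x \<notin> H \<and> y \<notin> H}"
    using rainbow_arcs_avoiding[OF GF neV _ degF crit] by blast
  define L where "L = {e. card e = 2 \<and> v \<notin> e \<and> rainbow_triangle V E C (insert v e)}"
  have "L \<subseteq> Pow V" by (auto simp: L_def rainbow_triangle_def is_triangle_def nsets_def)
  then have finL: "finite L" using finV finite_subset by blast
  have nomatch: "card M \<noteq> k" if "M \<subseteq> L" "pairwise disjnt M" for M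
  proof
    assume "card M = k"
    then have "friendship_triangles k v (insert v ` M)"
      using friendship_triangles_of_matching[of M v] that finite_subset[OF _ finL] by (auto simp: L_def)
    moreover have "\<forall>T\<in>insert v ` M. rainbow_triangle V E C T" using that by (auto simp: L_def)
    ultimately show False using no v by blast
  qed
  have "\<And>e. e \<in> L \<Longrightarrow> card e = 2" by (simp add: L_def)
  then obtain H where H: "finite H" "card H \<le> k - 1"
    and light: "card {(x, y). {x, y} \<in> L \<and> x \<notin> H \<and> y \<notin> H} \<le> 4 * (k - 1) * (2 * k - 1)"
    using matching_concentrates_edges[OF finL _ nomatch] by blast
  define X where "X = A - H"
  have "{(x, y). rainbow_triangle V F C {v, x, y} \<and> x \<notin> H \<and> y \<notin> H}
      \<subseteq> {(x, y). {x, y} \<in> L \<and> x \<notin> H \<and> y \<notin> H}"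
  proof (rule subrelI)
    fix x y assume "(x, y) \<in> {(x, y). rainbow_triangle V F C {v, x, y} \<and> x \<notin> H \<and> y \<notin> H}"
    then have r: "rainbow_triangle V F C {v, x, y}" and xy: "x \<notin> H" "y \<notin> H" by auto
    have "card {v, x, y} = 3" using r by (simp add: rainbow_triangle_def is_triangle_def nsets_def)
    then have "v \<noteq> x" "v \<noteq> y" "x \<noteq> y" by (auto simp: card_insert_if split: if_splits)
    then show "(x, y) \<in> {(x, y). {x, y} \<in> L \<and> x \<notin> H \<and> y \<notin> H}"
      using rainbow_triangle_mono[OF r FE] xy by (simp add: L_def)
  qed
  moreover have "finite {(x, y). {x, y} \<in> L \<and> x \<notin> H \<and> y \<notin> H}"
    by (rule finite_subset[of _ "V \<times> V"]) (use \<open>L \<subseteq> Pow V\<close> finV in auto)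
  ultimately have "card {(x, y). rainbow_triangle V F C {v, x, y} \<and> x \<notin> H \<and> y \<notin> H}
      \<le> 4 * (k - 1) * (2 * k - 1)"
    using light card_mono le_trans by blast
  then have bound: "card X * (2 * d) \<le> card X * (n + card H) + 4 * (k - 1) * (2 * k - 1)"
    using arcs[OF H(1)] unfolding X_def assms(4) by linarith
  have "card X * (n + card H) + card X * (k - 1) \<le> card X * (2 * d)"
    unfolding distrib_left[symmetric] using d H(2) assms(1) by (intro mult_le_mono2) linarith
  then have "card X * (k - 1) \<le> 4 * (k - 1) * (2 * k - 1)" using bound by linarith
  then have "(k - 1) * card X \<le> (k - 1) * (4 * (2 * k - 1))" by (simp only: mult_ac)
  then have "card X \<le> 4 * (2 * k - 1)" using assms(1) by simp
  moreover have "card A \<le> card X + card H" unfolding X_def using H(1)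
    by (metis card_Diff_subset_Int diff_card_le_card_Diff le_diff_conv)
  ultimately show False using A(2) d H(2) n_large assms(1) by linarith
qed

end
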